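(* Let $T\subset\mathbb{R}^2$ be an open triangle and let $\mathcal{P}=\{P_i : i\in I\}$ be a (possibly infinite) collection of translates of $T$ that is a $12$-fold covering of the whole plane $\mathbb{R}^2$. Then $\mathcal{P}$ is decomposable into two coverings, i.e. there is a partition $I=I_1\sqcup I_2$ such that each of $\{P_i : i\in I_1\}$ and $\{P_i: i\in I_2\}$ is a covering of $\mathbb{R}^2$.
   Context: An open triangle is the interior of the convex hull of three non-collinear points of the plane. A collection $\{P_i : i\in I\}$ of sets is an $m$-fold covering of a set $S$ if every point of $S$ is contained in at least $m$ members of the collection (i.e. in $P_i$ for at least $m$ indices $i$); a $1$-fold covering is called a covering. *)

theory Defs
  imports "HOL-Analysis.Analysis"
begin

definition open_triangle :: "(real^2) set \<Rightarrow> bool" where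
  "open_triangle T \<longleftrightarrow>
     (\<exists>a b c. \<not> collinear {a, b, c} \<and> T = interior (convex hull {a, b, c}))"

definition is_translate :: "'a::ab_group_add set \<Rightarrow> 'a set \<Rightarrow> bool" where
  "is_translate A T \<longleftrightarrow> (\<exists>v. A = (\<lambda>x. x + v) ` T)"

text \<open>
  Multiplicity is counted over indices, so equal sets with different indices count separately.
  A finite set \<open>J\<close> of indices is exhibited instead of bounding \<open>card {i \<in> I. x \<in> P i}\<close>,
  because \<^const>\<open>card\<close> is \<open>0\<close> on infinite sets.
\<close>
definition fold_covering :: "nat \<Rightarrow> 'i set \<Rightarrow> ('i \<Rightarrow> 'a set) \<Rightarrow> 'a set \<Rightarrow> bool" where
  "fold_covering m I P S \<longleftrightarrow>
     (\<forall>x\<in>S. \<exists>J. J \<subseteq> I \<and> finite J \<and> card J = m \<and> (\<forall>i\<in>J. x \<in> P i))"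

abbreviation covering :: "'i set \<Rightarrow> ('i \<Rightarrow> 'a set) \<Rightarrow> 'a set \<Rightarrow> bool" where
  "covering \<equiv> fold_covering 1"

lemma covering_iff: "covering I P S \<longleftrightarrow> S \<subseteq> (\<Union>i\<in>I. P i)"
proof
  assume "covering I P S"
  then show "S \<subseteq> (\<Union>i\<in>I. P i)"
    by (fastforce simp: fold_covering_def card_1_singleton_iff)
next
  assume *: "S \<subseteq> (\<Union>i\<in>I. P i)"
  show "covering I P S"
    unfolding fold_covering_def
  proof
    fix x assume "x \<in> S"
    with * obtain i where "i \<in> I" "x \<in> P i" by blast
    then show "\<exists>J. J \<subseteq> I \<and> finite J \<and> card J = 1 \<and> (\<forall>i\<in>J. x \<in> P i)"
      by (intro exI[of _ "{i}"]) auto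
  qed
qed

lemma fold_covering_iff_card:
  "fold_covering m I P S \<longleftrightarrow>
     (\<forall>x\<in>S. infinite {i \<in> I. x \<in> P i} \<or> m \<le> card {i \<in> I. x \<in> P i})"
proof -
  have "(\<exists>J. J \<subseteq> I \<and> finite J \<and> card J = m \<and> (\<forall>i\<in>J. x \<in> P i)) \<longleftrightarrow>
        infinite {i \<in> I. x \<in> P i} \<or> m \<le> card {i \<in> I. x \<in> P i}" (is "?L \<longleftrightarrow> ?R") for x
  proof
    assume ?L
    then obtain J where "J \<subseteq> I" "card J = m" "\<forall>i\<in>J. x \<in> P i" by (elim exE conjE)
    then have "J \<subseteq> {i \<in> I. x \<in> P i}" by auto
    with \<open>card J = m\<close> show ?R
      using card_mono[of "{i \<in> I. x \<in> P i}" J] by auto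
  next
    assume ?R
    then have "\<exists>J. J \<subseteq> {i \<in> I. x \<in> P i} \<and> finite J \<and> card J = m"
    proof
      assume "infinite {i \<in> I. x \<in> P i}"
      from infinite_arbitrarily_large[OF this, of m] show ?thesis by (elim exE conjE) (intro exI conjI)
    next
      assume "m \<le> card {i \<in> I. x \<in> P i}"
      from obtain_subset_with_card_n[OF this] show ?thesis by metis
    qed
    then obtain J where "J \<subseteq> {i \<in> I. x \<in> P i}" "finite J" "card J = m" by (elim exE conjE)
    then show ?L by (intro exI[of _ J]) auto
  qed
  then show ?thesis by (simp add: fold_covering_def)
qed

end

theory Submission
  imports Defs
begin

text \<open>
  Barycentric coordinates turn the translation vectors into points of \<open>\<real>\<^sup>3\<close> and each point of the
  plane into an octant, so a finite family needs a 2-colouring of a finite point set in which every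
  octant with 12 points is bichromatic. Points are inserted in the order of their third coordinate;
  octants become wedges \<open>{x < a, y < b}\<close>. Colours are fixed only relative to each other, inside
  components that have one root each. A new point lying above an old one is attached to it with the
  opposite colour; otherwise it becomes a root, and all roots above it are attached to it. If a wedge
  without a bichromatic component collects ten roots, four consecutive ones are joined in two pairs,
  chosen such that a wedge without a bichromatic component never has more than nine roots and two
  other points. Infinite families are handled by passing to a locally finite 12-fold subcovering,
  which exists because the triangles are open and bounded, and by compactness of \<open>{0,1}\<^sup>I\<close>.
\<close>

subsection \<open>Two-colouring points with respect to octants\<close>

lemma enumerate_by_key:
  fixes x :: "'a \<Rightarrow> real"
  assumes "finite F" "inj_on x F"
  shows "\<exists>f. f ` {..<card F} = F \<and> (\<forall>i j. i < j \<longrightarrow> j < card F \<longrightarrow> x (f i) < x (f j))"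
proof -
  define xs where "xs = sorted_list_of_set (x ` F)"
  have len: "length xs = card F" using assms by (simp add: xs_def card_image)
  have set: "set xs = x ` F" using assms by (simp add: xs_def)
  have sorted: "sorted_wrt (<) xs" by (simp add: xs_def)
  define f where "f i = the_inv_into F x (xs ! i)" for i
  have xf: "x (f i) = xs ! i" if "i < card F" for i
    unfolding f_def using f_the_inv_into_f[OF assms(2)] that len set nth_mem by metis
  have "f ` {..<card F} = the_inv_into F x ` set xs"
    by (auto simp: f_def set_conv_nth len image_iff)
  also have "\<dots> = F" unfolding set using assms(2) by (simp add: the_inv_into_onto)
  finally have "f ` {..<card F} = F" .
  moreover have "x (f i) < x (f j)" if "i < j" "j < card F" for i j
    using that xf sorted len by (simp add: sorted_wrt_nth_less)
  ultimately show ?thesis by blast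
qed

section \<open>States of the construction and the linking of components\<close>

locale planar_points =
  fixes x y :: "'a \<Rightarrow> real"
begin

definition below :: "'a \<Rightarrow> 'a \<Rightarrow> bool" where
  "below p q \<longleftrightarrow> x p \<le> x q \<and> y p \<le> y q"

definition wedge :: "'a set \<Rightarrow> real \<Rightarrow> real \<Rightarrow> 'a set" where
  "wedge S a b = {p \<in> S. x p < a \<and> y p < b}"

definition roots :: "('a \<Rightarrow> 'a) \<Rightarrow> 'a set \<Rightarrow> 'a set" where
  "roots r S = {p \<in> S. r p = p}"

text \<open>
  A state of the construction is a pair \<open>r\<close>, \<open>s\<close>: \<open>r p\<close> is the root of the component of \<open>p\<close>,
  and \<open>s p\<close> tells whether \<open>p\<close> has the colour opposite to \<open>r p\<close>. Colours of different components
  are not yet related, so only two points of one component count as differently coloured.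
\<close>
definition bichromatic :: "('a \<Rightarrow> 'a) \<Rightarrow> ('a \<Rightarrow> bool) \<Rightarrow> 'a set \<Rightarrow> bool" where
  "bichromatic r s W \<longleftrightarrow> (\<exists>p\<in>W. \<exists>q\<in>W. r p = r q \<and> s p \<noteq> s q)"

text \<open>By the last clause, a wedge without a bichromatic component contains no point below one
  of its roots except that root itself. In particular its roots form an antichain.\<close>

definition rooted :: "'a set \<Rightarrow> ('a \<Rightarrow> 'a) \<Rightarrow> ('a \<Rightarrow> bool) \<Rightarrow> bool" where
  "rooted S r s \<longleftrightarrow> finite S \<and>
     (\<forall>p\<in>S. r p \<in> S \<and> r (r p) = r p \<and> \<not> s (r p)) \<and>
     (\<forall>f\<in>S. \<forall>g\<in>S. r f = f \<longrightarrow> below g f \<longrightarrow> g \<noteq> f \<longrightarrow> bichromatic r s {p \<in> S. below p g})"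

text \<open>The parameter leaves room for one extra root: an insertion may raise it from 9 to 10
  until a reduction restores 9. The constant 2 allows for the two roots that one reduction turns
  into ordinary points.\<close>

definition sparse :: "nat \<Rightarrow> 'a set \<Rightarrow> ('a \<Rightarrow> 'a) \<Rightarrow> ('a \<Rightarrow> bool) \<Rightarrow> bool" where
  "sparse k S r s \<longleftrightarrow> (\<forall>a b. \<not> bichromatic r s (wedge S a b) \<longrightarrow>
     card (roots r (wedge S a b)) \<le> k \<and> card (wedge S a b - roots r S) \<le> 2)"

text \<open>Merges the components with roots in \<open>U\<close> into that of \<open>h\<close>. It
  goes together with \<open>flip\<close>, which reverses all colours in the merged components, so
  that their former roots become opposite to \<open>h\<close>.\<close>

definition link :: "'a set \<Rightarrow> 'a \<Rightarrow> ('a \<Rightarrow> 'a) \<Rightarrow> 'a \<Rightarrow> 'a" where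
  "link U h r p = (if r p \<in> U then h else r p)"

definition flip :: "'a set \<Rightarrow> ('a \<Rightarrow> 'a) \<Rightarrow> ('a \<Rightarrow> bool) \<Rightarrow> 'a \<Rightarrow> bool" where
  "flip U r s p = (if r p \<in> U then \<not> s p else s p)"

lemma bichromatic_mono: "bichromatic r s V \<Longrightarrow> V \<subseteq> W \<Longrightarrow> bichromatic r s W"
  unfolding bichromatic_def by blast

lemma bichromatic_cong:
  assumes "\<And>p. p \<in> W \<Longrightarrow> r' p = r p" "\<And>p. p \<in> W \<Longrightarrow> s' p = s p"
  shows "bichromatic r' s' W = bichromatic r s W"
  using assms unfolding bichromatic_def by auto

text \<open>Two points with a common root are both flipped or both left alone, and they still share
  a root afterwards.\<close>

lemma bichromatic_link: "bichromatic r s W \<Longrightarrow> bichromatic (link U h r) (flip U r s) W"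
proof -
  assume "bichromatic r s W"
  then obtain p q where "p \<in> W" "q \<in> W" "r p = r q" "s p \<noteq> s q"
    unfolding bichromatic_def by blast
  then show ?thesis
    unfolding bichromatic_def by (intro bexI[of _ p] bexI[of _ q]) (auto simp: link_def flip_def)
qed

lemma bichromatic_of_link:
  assumes "f \<in> W" "h \<in> W" "f \<in> U" "h \<notin> U" "r f = f" "r h = h" "\<not> s f" "\<not> s h"
  shows "bichromatic (link U h r) (flip U r s) W"
  unfolding bichromatic_def using assms by (intro bexI[of _ f] bexI[of _ h]) (auto simp: link_def flip_def)

lemma roots_link:
  assumes "h \<in> roots r S" "h \<notin> U" "U \<subseteq> roots r S"
  shows "roots (link U h r) S = roots r S - U"
  using assms unfolding roots_def link_def by auto

text \<open>Linking creates no new root and destroys no bichromatic set, so the condition on points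
  below a root carries over.\<close>

lemma rooted_link:
  assumes "rooted S r s" and "h \<in> roots r S" "h \<notin> U" "U \<subseteq> roots r S"
  shows "rooted S (link U h r) (flip U r s)"
proof -
  have "r p \<in> S \<and> r (r p) = r p \<and> \<not> s (r p)" if "p \<in> S" for p
    using assms(1) that unfolding rooted_def by blast
  then have 1: "\<forall>p\<in>S. link U h r p \<in> S \<and> link U h r (link U h r p) = link U h r p \<and> \<not> flip U r s (link U h r p)"
    using assms(2-4) unfolding link_def flip_def roots_def by (auto, metis)
  have 2: "bichromatic (link U h r) (flip U r s) {p \<in> S. below p g}"
    if "f \<in> S" "g \<in> S" "link U h r f = f" "below g f" "g \<noteq> f" for f g
  proof -
    have "f \<in> roots (link U h r) S" using that by (simp add: roots_def)
    then have "r f = f" using roots_link[OF assms(2-4)] by (auto simp: roots_def)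
    then show ?thesis using that assms(1) bichromatic_link unfolding rooted_def by blast
  qed
  show ?thesis using 1 2 assms(1) unfolding rooted_def by blast
qed

text \<open>Wedges are closed downwards under \<open>below\<close>.\<close>

lemma bichromatic_wedge_of_below:
  assumes "bichromatic r s {p \<in> S. below p g}" "g \<in> wedge S a b"
  shows "bichromatic r s (wedge S a b)"
  by (rule bichromatic_mono[OF assms(1)]) (use assms(2) in \<open>auto simp: wedge_def below_def\<close>)

lemma roots_wedge: "roots r (wedge S a b) = wedge S a b \<inter> roots r S"
  unfolding roots_def wedge_def by auto

section \<open>Inserting one point\<close>

text \<open>The new point gets the colour opposite to \<open>p\<close> within the component of
  \<open>p\<close>. Every wedge containing \<open>n\<close> contains \<open>p\<close> as well and is
  bichromatic, so a wedge that is not has the same points and roots as before.\<close>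

lemma insert_above:
  assumes inv: "rooted S r s" "sparse k S r s" and n: "n \<notin> S" "p \<in> S" "below p n"
  defines "r' \<equiv> r(n := r p)" and "s' \<equiv> s(n := \<not> s p)"
  shows "rooted (insert n S) r' s'" "sparse k (insert n S) r' s'"
    "W \<subseteq> S \<Longrightarrow> bichromatic r s W \<Longrightarrow> bichromatic r' s' W"
proof -
  have old: "r' q = r q" "s' q = s q" if "q \<in> S" for q
    using that n by (auto simp: r'_def s'_def)
  have rS: "r q \<in> S \<and> r (r q) = r q \<and> \<not> s (r q)" if "q \<in> S" for q
    using inv(1) that unfolding rooted_def by blast
  show keep: "bichromatic r' s' W" if "W \<subseteq> S" "bichromatic r s W" for W
    using that old bichromatic_cong[of W r' r s' s] by blast
  have gn: "bichromatic r' s' {p \<in> insert n S. below p n}"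
    unfolding bichromatic_def using n
    by (intro bexI[of _ n] bexI[of _ p]) (auto simp: r'_def s'_def below_def)
  have rn: "r' n \<noteq> n" using rS n by (auto simp: r'_def)
  have R: "roots r' (insert n S) = roots r S"
    using rn old by (auto simp: roots_def)
  show "rooted (insert n S) r' s'"
    unfolding rooted_def
  proof (intro conjI ballI impI)
    show "finite (insert n S)" using inv(1) by (simp add: rooted_def)
  next
    fix q assume "q \<in> insert n S"
    then have "r' q \<in> S" using rS n by (auto simp: r'_def)
    then show "r' q \<in> insert n S" by blast
    show "r' (r' q) = r' q" "\<not> s' (r' q)"
      using \<open>q \<in> insert n S\<close> \<open>r' q \<in> S\<close> rS old n by (auto simp: r'_def s'_def split: if_splits)
  next
    fix f g assume fg: "f \<in> insert n S" "g \<in> insert n S" "r' f = f" "below g f" "g \<noteq> f"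
    then have f: "f \<in> S" "r f = f" using rn old by auto
    show "bichromatic r' s' {p \<in> insert n S. below p g}"
    proof (cases "g = n")
      case True then show ?thesis using gn by simp
    next
      case False
      then have "bichromatic r s {p \<in> S. below p g}" using fg f inv(1) unfolding rooted_def by blast
      then have "bichromatic r' s' {p \<in> S. below p g}" by (intro keep) auto
      then show ?thesis by (rule bichromatic_mono) auto
    qed
  qed
  show "sparse k (insert n S) r' s'"
    unfolding sparse_def
  proof (intro allI impI)
    fix a b assume bad: "\<not> bichromatic r' s' (wedge (insert n S) a b)"
    then have "n \<notin> wedge (insert n S) a b" using bichromatic_wedge_of_below[OF gn] by blast
    then have W: "wedge (insert n S) a b = wedge S a b" by (auto simp: wedge_def)
    then have "\<not> bichromatic r s (wedge S a b)" using bad keep[of "wedge S a b"] by (auto simp: wedge_def)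
    moreover have "roots r' (wedge S a b) = roots r (wedge S a b)"
      using R W by (metis roots_wedge)
    ultimately show "card (roots r' (wedge (insert n S) a b)) \<le> k \<and>
        card (wedge (insert n S) a b - roots r' (insert n S)) \<le> 2"
      using inv(2) unfolding sparse_def W R by simp
  qed
qed

text \<open>The new point becomes a root, and all roots above it are linked to it. A wedge
  containing one of these also contains \<open>n\<close> and is bichromatic; any other wedge gains
  at most the root \<open>n\<close>.\<close>

lemma insert_minimal:
  assumes inv: "rooted S r s" "sparse k S r s" and n: "n \<notin> S" "\<And>p. p \<in> S \<Longrightarrow> \<not> below p n"
  shows "\<exists>r' s'. rooted (insert n S) r' s' \<and> sparse (Suc k) (insert n S) r' s' \<and>
    (\<forall>W\<subseteq>S. bichromatic r s W \<longrightarrow> bichromatic r' s' W)"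
proof -
  define U where "U = {f \<in> roots r S. below n f}"
  define r0 where "r0 = r(n := n)"
  define s0 where "s0 = s(n := False)"
  define r' where "r' = link U n r0"
  define s' where "s' = flip U r0 s0"
  have old: "r0 q = r q" "s0 q = s q" if "q \<in> S" for q
    using that n by (auto simp: r0_def s0_def)
  have rS: "r q \<in> S \<and> r (r q) = r q \<and> \<not> s (r q)" if "q \<in> S" for q
    using inv(1) that unfolding rooted_def by blast
  have R0: "roots r0 (insert n S) = insert n (roots r S)"
    using old by (auto simp: roots_def r0_def)
  have U: "n \<in> roots r0 (insert n S)" "n \<notin> U" "U \<subseteq> roots r0 (insert n S)"
    using R0 n(1) by (auto simp: U_def roots_def)
  have R: "roots r' (insert n S) = insert n (roots r S - U)"
    using roots_link[OF U] R0 U(2) by (auto simp: r'_def)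
  have keep: "bichromatic r' s' W" if "W \<subseteq> S" "bichromatic r s W" for W
  proof -
    have "bichromatic r0 s0 W" using that old bichromatic_cong[of W r0 r s0 s] by blast
    then show ?thesis unfolding r'_def s'_def by (rule bichromatic_link)
  qed
  have gU: "bichromatic r' s' W" if "n \<in> W" "f \<in> W" "f \<in> U" for W f
    unfolding r'_def s'_def
    by (rule bichromatic_of_link[OF that(2,1,3) U(2)])
      (use that(3) n(1) rS in \<open>auto simp: U_def roots_def r0_def s0_def, metis+\<close>)
  have A: "rooted (insert n S) r' s'"
    unfolding rooted_def
  proof (intro conjI ballI impI)
    show "finite (insert n S)" using inv(1) by (simp add: rooted_def)
  next
    fix q assume q: "q \<in> insert n S"
    have *: "r0 q \<in> insert n S \<and> r0 (r0 q) = r0 q \<and> \<not> s0 (r0 q)"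
      using q rS n by (auto simp: r0_def s0_def)
    then show "r' q \<in> insert n S" "r' (r' q) = r' q" "\<not> s' (r' q)"
      using U by (auto simp: r'_def s'_def link_def flip_def r0_def s0_def)
  next
    fix f g assume fg: "f \<in> insert n S" "g \<in> insert n S" "r' f = f" "below g f" "g \<noteq> f"
    then have "f \<in> insert n (roots r S - U)" using R by (auto simp: roots_def)
    moreover have "f \<noteq> n" using fg n by auto
    ultimately have f: "f \<in> S" "r f = f" "f \<in> roots r S" "f \<notin> U" by (auto simp: roots_def)
    \<comment> \<open>A surviving root does not lie above \<open>n\<close>, or it would be in
      \<open>U\<close>; so \<open>g\<close> is an old point.\<close>
    have "g \<noteq> n" using f fg by (auto simp: U_def)
    then have "bichromatic r s {p \<in> S. below p g}" using fg f inv(1) unfolding rooted_def by blast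
    then have "bichromatic r' s' {p \<in> S. below p g}" by (intro keep) auto
    then show "bichromatic r' s' {p \<in> insert n S. below p g}" by (rule bichromatic_mono) auto
  qed
  have B: "sparse (Suc k) (insert n S) r' s'"
    unfolding sparse_def
  proof (intro allI impI)
    fix a b assume bad: "\<not> bichromatic r' s' (wedge (insert n S) a b)"
    have sub: "wedge S a b \<subseteq> wedge (insert n S) a b" "wedge (insert n S) a b \<subseteq> insert n (wedge S a b)"
      by (auto simp: wedge_def)
    have fin: "finite (wedge S a b)" using inv(1) by (simp add: rooted_def wedge_def)
    have "\<not> bichromatic r s (wedge S a b)"
      using bad keep[of "wedge S a b"] bichromatic_mono[OF _ sub(1)] by (auto simp: wedge_def)
    then have c: "card (roots r (wedge S a b)) \<le> k" "card (wedge S a b - roots r S) \<le> 2"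
      using inv(2) by (auto simp: sparse_def)
    have "roots r' (wedge (insert n S) a b) \<subseteq> insert n (roots r (wedge S a b))"
      unfolding roots_wedge R using sub by auto
    then have "card (roots r' (wedge (insert n S) a b)) \<le> card (insert n (roots r (wedge S a b)))"
      by (rule card_mono[rotated]) (use fin in \<open>auto simp: roots_def\<close>)
    also have "\<dots> \<le> Suc k" using c(1) by (simp add: card_insert_if fin roots_def)
    finally have 1: "card (roots r' (wedge (insert n S) a b)) \<le> Suc k" .
    \<comment> \<open>The points of \<open>U\<close> are the only roots that were lost; keeping them
      out of the wedge keeps the bound 2 on its other points.\<close>
    have "U \<inter> wedge (insert n S) a b = {}"
    proof (rule ccontr)
      assume "U \<inter> wedge (insert n S) a b \<noteq> {}"
      then obtain f where f: "f \<in> U" "f \<in> wedge (insert n S) a b" by blast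
      then have "n \<in> wedge (insert n S) a b" by (auto simp: wedge_def U_def below_def)
      with f gU bad show False by blast
    qed
    then have "wedge (insert n S) a b - roots r' (insert n S) \<subseteq> wedge S a b - roots r S"
      unfolding R using sub by auto
    then have "card (wedge (insert n S) a b - roots r' (insert n S)) \<le> 2"
      using c(2) fin by (meson card_mono finite_Diff le_trans)
    with 1 show "card (roots r' (wedge (insert n S) a b)) \<le> Suc k \<and>
        card (wedge (insert n S) a b - roots r' (insert n S)) \<le> 2" by blast
  qed
  show ?thesis using A B keep by blast
qed


section \<open>Reducing the number of roots in a wedge\<close>

text \<open>
  Each \<open>g\<close> excludes at most three consecutive values of \<open>i\<close>, so two of them leave one of seven.
\<close>
lemma exists_free_zone:
  fixes f :: "nat \<Rightarrow> 'a"
  assumes x: "\<And>i j. i < j \<Longrightarrow> j < 10 \<Longrightarrow> x (f i) < x (f j)"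
    and N: "finite N" "card N \<le> 2"
    and above: "\<And>i g. i < 10 \<Longrightarrow> g \<in> N \<Longrightarrow> \<not> below g (f i)"
  shows "\<exists>i\<in>{1..7}. \<forall>g\<in>N. \<not> (x g < x (f (i + 2)) \<and> y g < y (f (i - 1)))"
proof -
  \<comment> \<open>The positions excluded by \<open>g\<close>. The range from 1 to 7 is chosen so
    that \<open>f (i - 1)\<close> to \<open>f (i + 2)\<close> all lie among the ten points.\<close>
  define B where "B g = {i \<in> {1..7}. x g < x (f (i + 2)) \<and> y g < y (f (i - 1))}" for g
  have "card (B g) \<le> 3" if "g \<in> N" for g
  proof (cases "B g = {}")
    case False
    have fin: "finite (B g)" by (simp add: B_def)
    have "j \<le> Min (B g) + 2" if "j \<in> B g" for j
    proof (rule ccontr)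
      define i where "i = Min (B g)"
      have i: "i \<in> B g" using fin False i_def by simp
      assume "\<not> j \<le> Min (B g) + 2"
      then have ij: "i + 2 \<le> j - 1" "j - 1 < 10" using that by (auto simp: i_def B_def)
      then have "x (f (i + 2)) \<le> x (f (j - 1))"
        using x[of "i + 2" "j - 1"] by (cases "i + 2 = j - 1") auto
      \<comment> \<open>The bound on \<open>x g\<close> comes from the position \<open>i\<close>,
        the bound on \<open>y g\<close> from \<open>j\<close>.\<close>
      then have "below g (f (j - 1))" using i that by (auto simp: B_def below_def)
      then show False using above ij \<open>g \<in> N\<close> by blast
    qed
    then have "B g \<subseteq> {Min (B g)..Min (B g) + 2}" using fin by auto
    then have "card (B g) \<le> card {Min (B g)..Min (B g) + 2}" by (intro card_mono) auto
    then show ?thesis by simp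
  qed simp
  then have "card (\<Union>g\<in>N. B g) \<le> card N * 3"
    using card_UN_le[OF N(1), of B] sum_bounded_above[of N "\<lambda>g. card (B g)" 3] by force
  then have "card (\<Union>g\<in>N. B g) < card {1..7::nat}" using N(2) by simp
  then have "\<not> {1..7} \<subseteq> (\<Union>g\<in>N. B g)"
    using card_mono[of "\<Union>g\<in>N. B g" "{1..7::nat}"] N(1) by (auto simp: B_def)
  then show ?thesis by (auto simp: B_def)
qed

text \<open>
  Both links point away from the gap between \<open>f i\<close> and \<open>f (i + 1)\<close>. Hence a wedge that reaches
  beyond \<open>wedge S a b\<close> on either side and contains \<open>f i\<close> or \<open>f (i + 1)\<close> contains a whole link, and
  the wedges that stay monochromatic lie in the zone found by \<open>exists_free_zone\<close>, where the only
  points that are not roots are \<open>f i\<close> and \<open>f (i + 1)\<close>.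
\<close>
lemma reduce_roots:
  assumes inv: "rooted S r s" "sparse 10 S r s"
    and bad: "\<not> bichromatic r s (wedge S a b)" and ten: "card (roots r (wedge S a b)) = 10"
  shows "\<exists>r' s'. rooted S r' s' \<and> sparse 10 S r' s' \<and> card (roots r' S) < card (roots r S) \<and>
    (\<forall>W. bichromatic r s W \<longrightarrow> bichromatic r' s' W)"
proof -
  let ?W = "wedge S a b"
  have fin: "finite S" using inv(1) by (simp add: rooted_def)
  \<comment> \<open>Hence the ten roots form an antichain: sorted by increasing \<open>x\<close>,
    they have decreasing \<open>y\<close>.\<close>
  have incomp: "\<not> below g f" if "g \<in> ?W" "f \<in> roots r ?W" "g \<noteq> f" for f g
  proof
    assume "below g f"
    moreover have "f \<in> S" "r f = f" "g \<in> S" using that by (auto simp: roots_def wedge_def)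
    ultimately have "bichromatic r s {p \<in> S. below p g}" using inv(1) that(3) unfolding rooted_def by blast
    then show False using bichromatic_wedge_of_below that(1) bad by blast
  qed
  have "inj_on x (roots r ?W)"
  proof (rule inj_onI, rule ccontr)
    fix p q assume pq: "p \<in> roots r ?W" "q \<in> roots r ?W" "x p = x q" "p \<noteq> q"
    then have "below p q \<or> below q p" by (auto simp: below_def)
    with pq incomp show False by (auto simp: roots_def)
  qed
  moreover have "finite (roots r ?W)" using fin by (simp add: roots_def wedge_def)
  ultimately have "\<exists>f :: nat \<Rightarrow> 'a. f ` {..<10} = roots r ?W \<and> (\<forall>i j. i < j \<longrightarrow> j < 10 \<longrightarrow> x (f i) < x (f j))"
    using enumerate_by_key[of "roots r ?W" x] unfolding ten by blast
  then obtain f :: "nat \<Rightarrow> 'a" where f: "f ` {..<10} = roots r ?W"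
      and x: "\<And>i j. i < j \<Longrightarrow> j < 10 \<Longrightarrow> x (f i) < x (f j)"
    by blast
  have fR: "f i \<in> roots r ?W" if "i < 10" for i using f that by blast
  have fW: "f i \<in> ?W" "r (f i) = f i" "f i \<in> roots r S" "f i \<in> S" if "i < 10" for i
    using fR[OF that] by (auto simp: roots_def wedge_def)
  have nf: "\<not> s (f i)" if "i < 10" for i
    using fW[OF that] inv(1) unfolding rooted_def by metis
  have fneq: "f i \<noteq> f j" if "i < j" "j < 10" for i j using x[OF that] by auto
  have y: "y (f j) < y (f i)" if "i < j" "j < 10" for i j
    using incomp[OF fW(1) fR, of i j] x[OF that] that fneq[OF that] by (auto simp: below_def)
  define N where "N = ?W - roots r S"
  have N: "finite N" "card N \<le> 2"
    using fin inv(2) bad by (auto simp: N_def wedge_def sparse_def)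
  have above: "\<not> below g (f i)" if "i < 10" "g \<in> N" for i g
    using that incomp[OF _ fR, of g i] fW(3)[of i] by (auto simp: N_def)
  have "\<exists>i\<in>{1..7}. \<forall>g\<in>N. \<not> (x g < x (f (i + 2)) \<and> y g < y (f (i - 1)))"
    by (rule exists_free_zone[OF _ N]) (use x above in blast)+
  then obtain i where "i \<in> {1..7}"
      and free: "\<forall>g\<in>N. \<not> (x g < x (f (i + 2)) \<and> y g < y (f (i - 1)))"
    by blast
  then have i: "1 \<le> i" "i \<le> 7" by auto
  define r1 where "r1 = link {f i} (f (i - 1)) r"
  define s1 where "s1 = flip {f i} r s"
  define r2 where "r2 = link {f (i + 1)} (f (i + 2)) r1"
  define s2 where "s2 = flip {f (i + 1)} r1 s1"
  have ne: "f (i - 1) \<noteq> f i" "f (i + 1) \<noteq> f (i + 2)" "f i \<noteq> f (i + 1)" "f i \<noteq> f (i + 2)"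
    using fneq[of "i - 1" i] fneq[of i "i + 1"] fneq[of i "i + 2"] fneq[of "i + 1" "i + 2"] i by auto
  have P1: "f (i - 1) \<in> roots r S" "f (i - 1) \<notin> {f i}" "{f i} \<subseteq> roots r S"
    using fW(3)[of i] fW(3)[of "i - 1"] i ne by auto
  have R1: "roots r1 S = roots r S - {f i}" unfolding r1_def by (rule roots_link[OF P1])
  have rt1: "rooted S r1 s1" unfolding r1_def s1_def by (rule rooted_link[OF inv(1) P1])
  have P2: "f (i + 2) \<in> roots r1 S" "f (i + 2) \<notin> {f (i + 1)}" "{f (i + 1)} \<subseteq> roots r1 S"
    unfolding R1 using fW(3)[of "i + 1"] fW(3)[of "i + 2"] i ne by auto
  have R2: "roots r2 S = roots r S - {f i, f (i + 1)}"
    unfolding r2_def roots_link[OF P2] R1 by auto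
  have rt2: "rooted S r2 s2" unfolding r2_def s2_def by (rule rooted_link[OF rt1 P2])
  have keep: "bichromatic r2 s2 W" if "bichromatic r s W" for W
    unfolding r2_def s2_def r1_def s1_def by (intro bichromatic_link that)
  have g1: "bichromatic r2 s2 W" if "f (i - 1) \<in> W" "f i \<in> W" for W
    unfolding r2_def s2_def
    by (rule bichromatic_link, unfold r1_def s1_def, rule bichromatic_of_link[OF that(2,1)])
      (use i fW(2) nf ne in auto)
  have g2: "bichromatic r2 s2 W" if "f (i + 1) \<in> W" "f (i + 2) \<in> W" for W
    unfolding r2_def s2_def
    by (rule bichromatic_of_link[OF that])
      (use i fW(2) nf ne in \<open>auto simp: r1_def s1_def link_def flip_def\<close>)
  have "sparse 10 S r2 s2"
    unfolding sparse_def
  proof (intro allI impI)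
    fix c d assume bad2: "\<not> bichromatic r2 s2 (wedge S c d)"
    let ?V = "wedge S c d"
    have finV: "finite ?V" using fin by (simp add: wedge_def)
    have "\<not> bichromatic r s ?V" using bad2 keep by blast
    then have old: "card (roots r ?V) \<le> 10" "card (?V - roots r S) \<le> 2"
      using inv(2) by (auto simp: sparse_def)
    have "finite (roots r ?V)" using finV by (simp add: roots_def)
    moreover have "roots r2 ?V \<subseteq> roots r ?V" unfolding roots_wedge R2 by auto
    ultimately have 1: "card (roots r2 ?V) \<le> 10"
      using old(1) card_mono le_trans by blast
    have "card (?V - roots r2 S) \<le> 2"
    proof (cases "f i \<in> ?V \<or> f (i + 1) \<in> ?V")
      case False
      then have "?V - roots r2 S = ?V - roots r S" unfolding R2 by auto
      then show ?thesis using old(2) by simp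
    next
      case True
      have S4: "f (i - 1) \<in> S" "f i \<in> S" "f (i + 1) \<in> S" "f (i + 2) \<in> S"
        using fW(4) i by auto
      have xs: "x (f (i - 1)) < x (f i)" "x (f i) < x (f (i + 1))" "x (f (i + 1)) < x (f (i + 2))"
        using x[of "i - 1" i] x[of i "i + 1"] x[of "i + 1" "i + 2"] i by auto
      have ys: "y (f i) < y (f (i - 1))" "y (f (i + 1)) < y (f i)" "y (f (i + 2)) < y (f (i + 1))"
        using y[of "i - 1" i] y[of i "i + 1"] y[of "i + 1" "i + 2"] i by auto
      have "\<not> (f (i - 1) \<in> ?V \<and> f i \<in> ?V)" "\<not> (f (i + 1) \<in> ?V \<and> f (i + 2) \<in> ?V)"
        using g1 g2 bad2 by auto
      \<comment> \<open>If \<open>f (i + 1)\<close> is in the wedge, then \<open>f (i + 2)\<close>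
        is not, and having smaller \<open>y\<close> it must violate the bound \<open>c\<close>. If
        only \<open>f i\<close> is in the wedge, \<open>f (i + 1)\<close> already violates
        \<open>c\<close>. The bound on \<open>d\<close> is symmetric.\<close>
      then have cd: "c \<le> x (f (i + 2))" "d \<le> y (f (i - 1))"
        using True S4 xs ys by (auto simp: wedge_def)
      have ab: "x (f (i + 2)) < a" "y (f (i - 1)) < b"
        using fW(1)[of "i + 2"] fW(1)[of "i - 1"] i by (auto simp: wedge_def)
      have "?V - roots r2 S \<subseteq> {f i, f (i + 1)}"
      proof
        fix g assume g: "g \<in> ?V - roots r2 S"
        show "g \<in> {f i, f (i + 1)}"
        proof (rule ccontr)
          assume "g \<notin> {f i, f (i + 1)}"
          \<comment> \<open>By \<open>cd\<close> and \<open>ab\<close> the new wedge lies inside the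
            old one, and \<open>g\<close> was not a root before the links either.\<close>
          then have "g \<in> N" using g cd ab by (auto simp: N_def R2 wedge_def)
          then show False using free g cd by (auto simp: wedge_def)
        qed
      qed
      then have "card (?V - roots r2 S) \<le> card {f i, f (i + 1)}" by (intro card_mono) auto
      also have "\<dots> \<le> 2" by (simp add: card_insert_if)
      finally show ?thesis .
    qed
    with 1 show "card (roots r2 ?V) \<le> 10 \<and> card (?V - roots r2 S) \<le> 2" by blast
  qed
  moreover have "card (roots r2 S) < card (roots r S)"
    unfolding R2 by (rule psubset_card_mono) (use fin P1 in \<open>auto simp: roots_def\<close>)
  ultimately show ?thesis using rt2 keep by blast
qed

text \<open>Every reduction lowers the total number of roots, so repeating it at wedges with ten
  roots terminates.\<close>

lemma reduce_roots_to_9: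
  assumes "rooted S r s" "sparse 10 S r s"
  shows "\<exists>r' s'. rooted S r' s' \<and> sparse 9 S r' s' \<and> (\<forall>W. bichromatic r s W \<longrightarrow> bichromatic r' s' W)"
  using assms
proof (induction "card (roots r S)" arbitrary: r s rule: less_induct)
  case less
  show ?case
  proof (cases "sparse 9 S r s")
    case False
    then obtain a b where bad: "\<not> bichromatic r s (wedge S a b)" and "\<not> card (roots r (wedge S a b)) \<le> 9"
      using less.prems(2) unfolding sparse_def by blast
    moreover have "card (roots r (wedge S a b)) \<le> 10"
      using less.prems(2) bad unfolding sparse_def by blast
    ultimately have "card (roots r (wedge S a b)) = 10" by linarith
    then obtain r1 s1 where "rooted S r1 s1" "sparse 10 S r1 s1" "card (roots r1 S) < card (roots r S)"
        "\<forall>W. bichromatic r s W \<longrightarrow> bichromatic r1 s1 W"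
      using reduce_roots[OF less.prems bad] by blast
    then show ?thesis using less.hyps[of r1 s1] by blast
  qed (use less.prems in blast)
qed

lemma insert_point:
  assumes "rooted S r s" "sparse 9 S r s" "n \<notin> S"
  shows "\<exists>r' s'. rooted (insert n S) r' s' \<and> sparse 9 (insert n S) r' s' \<and>
    (\<forall>W\<subseteq>S. bichromatic r s W \<longrightarrow> bichromatic r' s' W)"
proof (cases "\<exists>p\<in>S. below p n")
  case True
  then show ?thesis using insert_above[OF assms] by blast
next
  case False
  then obtain r1 s1 where "rooted (insert n S) r1 s1" "sparse 10 (insert n S) r1 s1"
      "\<forall>W\<subseteq>S. bichromatic r s W \<longrightarrow> bichromatic r1 s1 W"
    using insert_minimal[OF assms] by auto
  then show ?thesis using reduce_roots_to_9[of "insert n S" r1 s1] by blast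
qed

text \<open>Nine roots and two other points make only 11.\<close>

lemma bichromatic_if_card_ge_12:
  assumes "rooted S r s" "sparse 9 S r s" "12 \<le> card (wedge S a b)"
  shows "bichromatic r s (wedge S a b)"
proof (rule ccontr)
  let ?W = "wedge S a b"
  assume "\<not> bichromatic r s ?W"
  then have "card (roots r ?W) \<le> 9" "card (?W - roots r S) \<le> 2"
    using assms(2) unfolding sparse_def by blast+
  moreover have "?W = roots r ?W \<union> (?W - roots r S)" unfolding roots_wedge by auto
  then have "card ?W \<le> card (roots r ?W) + card (?W - roots r S)" by (metis card_Un_le)
  ultimately show False using assms(3) by simp
qed

end

section \<open>Octants, by induction along the third coordinate\<close>

theorem octants_bichromatic:
  fixes x y z :: "'a \<Rightarrow> real"
  assumes "finite A"
  shows "\<exists>col. \<forall>a b c. 12 \<le> card {i \<in> A. x i < a \<and> y i < b \<and> z i < c} \<longrightarrow>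
    (\<exists>i\<in>A. x i < a \<and> y i < b \<and> z i < c \<and> col i) \<and>
    (\<exists>i\<in>A. x i < a \<and> y i < b \<and> z i < c \<and> \<not> col i)"
proof -
  interpret planar_points x y .
  have "\<exists>r s. rooted A r s \<and> sparse 9 A r s \<and>
    (\<forall>a b c. 12 \<le> card {i \<in> A. x i < a \<and> y i < b \<and> z i < c} \<longrightarrow>
       bichromatic r s {i \<in> A. x i < a \<and> y i < b \<and> z i < c})"
    using assms
  proof (induction A rule: finite_ranking_induct[where f = z])
    case empty
    show ?case by (intro exI[of _ id] exI[of _ "\<lambda>_. False"])
      (auto simp: rooted_def sparse_def wedge_def roots_def)
  next
    case (insert n S)
    show ?case
    proof (cases "n \<in> S")
      case True then show ?thesis using insert.IH by (simp add: insert_absorb)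
    next
      case False
      obtain r s where rs: "rooted S r s" "sparse 9 S r s"
        and IH: "\<And>a b c. 12 \<le> card {i \<in> S. x i < a \<and> y i < b \<and> z i < c} \<Longrightarrow>
           bichromatic r s {i \<in> S. x i < a \<and> y i < b \<and> z i < c}"
        using insert.IH by blast
      obtain r' s' where rs': "rooted (insert n S) r' s'" "sparse 9 (insert n S) r' s'"
        and keep: "\<And>W. W \<subseteq> S \<Longrightarrow> bichromatic r s W \<Longrightarrow> bichromatic r' s' W"
        using insert_point[OF rs False] by blast
      have "bichromatic r' s' {i \<in> insert n S. x i < a \<and> y i < b \<and> z i < c}"
        if "12 \<le> card {i \<in> insert n S. x i < a \<and> y i < b \<and> z i < c}" for a b c
      proof (cases "z n < c")
        \<comment> \<open>All points so far have third coordinate at most \<open>z n\<close>, so the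
          condition on \<open>z\<close> is vacuous and the octant is a wedge. An octant without
          \<open>n\<close> was settled earlier, and bichromatic sets stay so.\<close>
        case True
        then have "{i \<in> insert n S. x i < a \<and> y i < b \<and> z i < c} = wedge (insert n S) a b"
          using le_less_trans[OF insert.hyps(2)] by (auto simp: wedge_def)
        then show ?thesis using bichromatic_if_card_ge_12[OF rs'] that by simp
      next
        case False
        then have "{i \<in> insert n S. x i < a \<and> y i < b \<and> z i < c} =
            {i \<in> S. x i < a \<and> y i < b \<and> z i < c}" by auto
        then show ?thesis using IH[of a b c] keep[of "{i \<in> S. x i < a \<and> y i < b \<and> z i < c}"] that
          by auto
      qed
      then show ?thesis using rs' by blast
    qed
  qed
  then obtain r s where "\<And>a b c. 12 \<le> card {i \<in> A. x i < a \<and> y i < b \<and> z i < c} \<Longrightarrow>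
       bichromatic r s {i \<in> A. x i < a \<and> y i < b \<and> z i < c}" by blast
  \<comment> \<open>Giving all roots the same colour relates the components, so \<open>s\<close>
    itself serves as the colouring.\<close>
  then have "\<exists>p\<in>{i \<in> A. x i < a \<and> y i < b \<and> z i < c}. \<exists>q\<in>{i \<in> A. x i < a \<and> y i < b \<and> z i < c}. s p \<noteq> s q"
    if "12 \<le> card {i \<in> A. x i < a \<and> y i < b \<and> z i < c}" for a b c
    using that unfolding bichromatic_def by meson
  then show ?thesis by (intro exI[of _ s]) blast
qed

subsection \<open>From triangles to octants\<close>

lemma cross_eq_0_imp_collinear:
  fixes a b c :: "real^2"
  assumes "(b - a) $ 1 * (c - a) $ 2 = (b - a) $ 2 * (c - a) $ 1"
  shows "collinear {a, b, c}"
proof (cases "b = a")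
  case False
  define p where "p = b - a"
  define q where "q = c - a"
  have pq: "p $ 1 * q $ 2 = p $ 2 * q $ 1" using assms by (simp add: p_def q_def)
  have "p \<noteq> 0" using False by (simp add: p_def)
  then have "p $ 1 \<noteq> 0 \<or> p $ 2 \<noteq> 0" by (auto simp: vec_eq_iff forall_2)
  then have "\<exists>t. q = t *\<^sub>R p"
  proof
    assume "p $ 1 \<noteq> 0"
    then show ?thesis using pq
      by (intro exI[of _ "q $ 1 / p $ 1"]) (auto simp: vec_eq_iff forall_2 field_simps)
  next
    assume "p $ 2 \<noteq> 0"
    then show ?thesis using pq
      by (intro exI[of _ "q $ 2 / p $ 2"]) (auto simp: vec_eq_iff forall_2 field_simps)
  qed
  then have "collinear {0, b - a, c - a}" unfolding collinear_lemma p_def q_def by blast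
  moreover have "collinear {a, b, c} \<longleftrightarrow> collinear {b, a, c}" by (simp add: insert_commute)
  moreover have "collinear {b, a, c} \<longleftrightarrow> collinear {0, b - a, c - a}"
    by (auto simp: collinear_def)
  ultimately show ?thesis by blast
qed simp

text \<open>\<open>q\<close> lies in the translate iff the three barycentric coordinates of
  \<open>q - v\<close> are positive. They are affine, so each inequality separates into a linear
  function of \<open>v\<close> and a function of \<open>q\<close>.\<close>

lemma translates_as_octants:
  assumes "open_triangle T"
  obtains X Y Z A B C :: "real^2 \<Rightarrow> real"
  where "\<And>q v. q \<in> (\<lambda>u. u + v) ` T \<longleftrightarrow> X v < A q \<and> Y v < B q \<and> Z v < C q"
proof -
  obtain a b c where nc: "\<not> collinear {a, b, c}" and T: "T = interior (convex hull {a, b, c})"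
    using assms unfolding open_triangle_def by blast
  define D where "D = (b - a) $ 1 * (c - a) $ 2 - (b - a) $ 2 * (c - a) $ 1"
  have D: "D \<noteq> 0" using nc cross_eq_0_imp_collinear[of b a c] by (auto simp: D_def)
  \<comment> \<open>Cramer's rule for the coordinates of \<open>w\<close> in the basis
    \<open>b - a\<close>, \<open>c - a\<close>, whose determinant is \<open>D\<close>.\<close>
  define X where "X w = (w $ 1 * (c - a) $ 2 - w $ 2 * (c - a) $ 1) / D" for w :: "real^2"
  define Y where "Y w = ((b - a) $ 1 * w $ 2 - (b - a) $ 2 * w $ 1) / D" for w :: "real^2"
  have lin: "X (u - v) = X u - X v" "Y (u - v) = Y u - Y v" for u v
    by (simp_all add: X_def Y_def diff_divide_distrib [symmetric] algebra_simps)
  have DX: "D * X w = w $ 1 * (c - a) $ 2 - w $ 2 * (c - a) $ 1"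
    and DY: "D * Y w = (b - a) $ 1 * w $ 2 - (b - a) $ 2 * w $ 1" for w
    using D by (simp_all add: X_def Y_def)
  have expand: "w = X w *\<^sub>R (b - a) + Y w *\<^sub>R (c - a)" for w
  proof -
    have "D * w $ i = D * X w * (b - a) $ i + D * Y w * (c - a) $ i" if "i = 1 \<or> i = 2" for i
      using that unfolding DX DY unfolding D_def by (auto simp: algebra_simps)
    then have "D * w $ i = D * (X w *\<^sub>R (b - a) + Y w *\<^sub>R (c - a)) $ i" if "i = 1 \<or> i = 2" for i
      using that by (simp add: algebra_simps)
    then show ?thesis using D by (simp add: vec_eq_iff forall_2)
  qed
  have coord: "X (s *\<^sub>R (b - a) + t *\<^sub>R (c - a)) = s" "Y (s *\<^sub>R (b - a) + t *\<^sub>R (c - a)) = t" for s t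
  proof -
    have "D * X (s *\<^sub>R (b - a) + t *\<^sub>R (c - a)) = D * s"
      unfolding DX unfolding D_def by (simp add: algebra_simps)
    then show "X (s *\<^sub>R (b - a) + t *\<^sub>R (c - a)) = s" using D by simp
    have "D * Y (s *\<^sub>R (b - a) + t *\<^sub>R (c - a)) = D * t"
      unfolding DY unfolding D_def by (simp add: algebra_simps)
    then show "Y (s *\<^sub>R (b - a) + t *\<^sub>R (c - a)) = t" using D by simp
  qed
  have memT: "u \<in> T \<longleftrightarrow> 0 < X (u - a) \<and> 0 < Y (u - a) \<and> X (u - a) + Y (u - a) < 1" for u
  proof -
    have "u \<in> T \<longleftrightarrow> (\<exists>r s t. 0 < r \<and> 0 < s \<and> 0 < t \<and> r + s + t = 1 \<and> r *\<^sub>R a + s *\<^sub>R b + t *\<^sub>R c = u)"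
      unfolding T using interior_convex_hull_3_minimal[OF nc] by simp
    also have "\<dots> \<longleftrightarrow> (\<exists>s t. 0 < s \<and> 0 < t \<and> s + t < 1 \<and> u - a = s *\<^sub>R (b - a) + t *\<^sub>R (c - a))"
    proof (intro iffI; elim exE conjE)
      fix r s t :: real assume "0 < r" "0 < s" "0 < t" "r + s + t = 1" "r *\<^sub>R a + s *\<^sub>R b + t *\<^sub>R c = u"
      moreover from this have "r = 1 - s - t" by simp
      ultimately show "\<exists>s t. 0 < s \<and> 0 < t \<and> s + t < 1 \<and> u - a = s *\<^sub>R (b - a) + t *\<^sub>R (c - a)"
        by (intro exI[of _ s] exI[of _ t]) (auto simp: algebra_simps)
    next
      fix s t :: real assume "0 < s" "0 < t" "s + t < 1" and u: "u - a = s *\<^sub>R (b - a) + t *\<^sub>R (c - a)"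
      moreover have "(1 - s - t) *\<^sub>R a + s *\<^sub>R b + t *\<^sub>R c = u"
        using u by (simp add: algebra_simps)
      ultimately show "\<exists>r s t. 0 < r \<and> 0 < s \<and> 0 < t \<and> r + s + t = 1 \<and> r *\<^sub>R a + s *\<^sub>R b + t *\<^sub>R c = u"
        by (intro exI[of _ "1 - s - t"] exI[of _ s] exI[of _ t]) auto
    qed
    also have "\<dots> \<longleftrightarrow> 0 < X (u - a) \<and> 0 < Y (u - a) \<and> X (u - a) + Y (u - a) < 1"
      using coord expand by metis
    finally show ?thesis .
  qed
  have "q \<in> (\<lambda>u. u + v) ` T \<longleftrightarrow> q - v \<in> T" for q v
    by (metis (no_types) add_diff_cancel diff_add_cancel image_iff)
  then have "q \<in> (\<lambda>u. u + v) ` T \<longleftrightarrow>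
      X v < X (q - a) \<and> Y v < Y (q - a) \<and> - X v - Y v < 1 - X (q - a) - Y (q - a)" for q v
    unfolding memT lin by auto
  then show ?thesis by (rule that)
qed

subsection \<open>Compactness\<close>

text \<open>The \<open>m\<close> sets chosen at \<open>q\<close> have an open intersection, on which
  the same indices serve every point; finitely many such intersections cover \<open>K\<close>. Each
  chosen set contains its centre \<open>q\<close>, hence meets \<open>K\<close>.\<close>

lemma compact_fold_subcovering:
  assumes "compact K" "\<And>i. i \<in> I \<Longrightarrow> open (P i)" "fold_covering m I P K"
  obtains F where "F \<subseteq> I" "finite F" "fold_covering m F P K" "\<And>i. m > 0 \<Longrightarrow> i \<in> F \<Longrightarrow> P i \<inter> K \<noteq> {}"
proof -
  obtain J where J: "\<And>q. q \<in> K \<Longrightarrow> J q \<subseteq> I \<and> finite (J q) \<and> card (J q) = m \<and> (\<forall>i\<in>J q. q \<in> P i)"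
    using assms(3) unfolding fold_covering_def by metis
  have "open (\<Inter>i\<in>J q. P i)" if "q \<in> K" for q
    using J[OF that] assms(2) by (intro open_INT) auto
  moreover have "K \<subseteq> (\<Union>q\<in>K. \<Inter>i\<in>J q. P i)" using J by auto
  ultimately obtain Q where Q: "Q \<subseteq> K" "finite Q" "K \<subseteq> (\<Union>q\<in>Q. \<Inter>i\<in>J q. P i)"
    using compactE_image[OF assms(1), of K "\<lambda>q. \<Inter>i\<in>J q. P i"] by metis
  show ?thesis
  proof (rule that[of "\<Union>q\<in>Q. J q"])
    show "fold_covering m (\<Union>q\<in>Q. J q) P K"
      unfolding fold_covering_def
    proof
      fix p assume "p \<in> K"
      then obtain q where q: "q \<in> Q" "p \<in> (\<Inter>i\<in>J q. P i)" using Q(3) by blast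
      then show "\<exists>F\<subseteq>\<Union>q\<in>Q. J q. finite F \<and> card F = m \<and> (\<forall>i\<in>F. p \<in> P i)"
        using J[of q] Q(1) by (intro exI[of _ "J q"]) auto
    qed
  qed (use Q J in blast)+
qed

text \<open>Finite subcoverings are chosen on the compact shells \<open>K n\<close>. A set of
  diameter at most \<open>d\<close> that contains \<open>q\<close> and meets \<open>K n\<close>
  forces \<open>n\<close> to be at most \<open>norm q + d\<close>, so only finitely many shells
  contribute at \<open>q\<close>.\<close>

lemma locally_finite_fold_subcovering:
  fixes P :: "'i \<Rightarrow> 'a::euclidean_space set"
  assumes op: "\<And>i. i \<in> I \<Longrightarrow> open (P i)"
    and diam: "\<And>i p q. i \<in> I \<Longrightarrow> p \<in> P i \<Longrightarrow> q \<in> P i \<Longrightarrow> dist p q \<le> d"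
    and cov: "fold_covering m I P UNIV" and "m > 0"
  obtains J where "J \<subseteq> I" "fold_covering m J P UNIV" "\<And>q. finite {i \<in> J. q \<in> P i}"
proof -
  define K :: "nat \<Rightarrow> 'a set" where "K n = cball 0 (real n + 1) - ball 0 (real n)" for n
  have "\<exists>F. F \<subseteq> I \<and> finite F \<and> fold_covering m F P (K n) \<and> (\<forall>i\<in>F. P i \<inter> K n \<noteq> {})" for n
  proof -
    have "compact (K n)" unfolding K_def by (intro compact_diff) auto
    moreover have "fold_covering m I P (K n)" using cov by (auto simp: fold_covering_def)
    ultimately obtain F where "F \<subseteq> I" "finite F" "fold_covering m F P (K n)"
        "\<And>i. m > 0 \<Longrightarrow> i \<in> F \<Longrightarrow> P i \<inter> K n \<noteq> {}"
      using compact_fold_subcovering[of "K n" I P m] op by blast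
    then show ?thesis using \<open>m > 0\<close> by blast
  qed
  then have "\<exists>F. \<forall>n. F n \<subseteq> I \<and> finite (F n) \<and> fold_covering m (F n) P (K n) \<and>
      (\<forall>i\<in>F n. P i \<inter> K n \<noteq> {})"
    by (intro choice) blast
  then obtain F where F: "\<And>n. F n \<subseteq> I" "\<And>n. finite (F n)" "\<And>n. fold_covering m (F n) P (K n)"
      "\<And>n i. i \<in> F n \<Longrightarrow> P i \<inter> K n \<noteq> {}"
    by blast
  show ?thesis
  proof (rule that[of "\<Union>n. F n"])
    show "(\<Union>n. F n) \<subseteq> I" using F(1) by blast
    show "fold_covering m (\<Union>n. F n) P UNIV"
      unfolding fold_covering_def
    proof
      fix q :: 'a
      have "q \<in> K (nat \<lfloor>norm q\<rfloor>)" by (simp add: K_def) linarith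
      then obtain J where "J \<subseteq> F (nat \<lfloor>norm q\<rfloor>)" "finite J" "card J = m" "\<forall>i\<in>J. q \<in> P i"
        using F(3) unfolding fold_covering_def by blast
      then show "\<exists>J\<subseteq>\<Union>n. F n. finite J \<and> card J = m \<and> (\<forall>i\<in>J. q \<in> P i)" by blast
    qed
  next
    fix q :: 'a
    have "n \<le> nat \<lceil>norm q + d\<rceil>" if i: "i \<in> F n" "q \<in> P i" for i n
    proof -
      obtain p where p: "p \<in> P i" "p \<in> K n" using F(4) i(1) by blast
      then have "real n \<le> norm p" by (simp add: K_def)
      also have "\<dots> \<le> norm q + dist p q" by (metis add.commute dist_norm norm_triangle_sub)
      also have "\<dots> \<le> norm q + d" using diam[OF subsetD[OF F(1) i(1)] p(1) i(2)] by simp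
      finally show ?thesis by linarith
    qed
    then have "{i \<in> \<Union>n. F n. q \<in> P i} \<subseteq> (\<Union>n\<le>nat \<lceil>norm q + d\<rceil>. F n)" by blast
    then show "finite {i \<in> \<Union>n. F n. q \<in> P i}" using F(2) by (meson finite_UN finite_atMost finite_subset)
  qed
qed

text \<open>The colourings form a compact space by Tychonoff's theorem. The condition at
  \<open>q\<close> concerns only the finitely many coordinates in \<open>F q\<close>, so it is
  closed, and the finite intersection property applies.\<close>

lemma two_colouring_compactness:
  fixes F :: "'q \<Rightarrow> 'i set"
  assumes fin: "\<And>q. finite (F q)"
    and local: "\<And>Q. finite Q \<Longrightarrow> \<exists>col. \<forall>q\<in>Q. (\<exists>i\<in>F q. col i) \<and> (\<exists>i\<in>F q. \<not> col i)"
  shows "\<exists>col. \<forall>q. (\<exists>i\<in>F q. col i) \<and> (\<exists>i\<in>F q. \<not> col i)"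
proof -
  define X :: "('i \<Rightarrow> bool) topology" where "X = product_topology (\<lambda>_. discrete_topology UNIV) UNIV"
  have "compact_space X"
    unfolding X_def compact_space_product_topology by (simp add: compact_space_discrete_topology)
  define C where "C q = {col. (\<exists>i\<in>F q. col i) \<and> (\<exists>i\<in>F q. \<not> col i)}" for q
  have top: "topspace X = UNIV" by (simp add: X_def)
  have clo: "closedin X {col. col i \<in> B}" for i B
    using closedin_continuous_map_preimage[of X "discrete_topology UNIV" "\<lambda>col. col i" B]
      continuous_map_product_projection[of i UNIV "\<lambda>_. discrete_topology UNIV"]
    by (simp add: X_def)
  have "closedin X (C q)" for q
  proof -
    have "C q = (\<Union>i\<in>F q. {col. col i \<in> {True}}) \<inter> (\<Union>i\<in>F q. {col. col i \<in> {False}})"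
      by (auto simp: C_def)
    moreover have "closedin X (\<Union>i\<in>F q. {col. col i \<in> B})" for B
      using fin clo by (intro closedin_Union) auto
    ultimately show ?thesis by (metis closedin_Int)
  qed
  moreover have "\<Inter>\<F> \<noteq> {}" if F: "finite \<F>" "\<F> \<subseteq> range C" for \<F>
  proof -
    obtain Q where Q: "finite Q" "\<F> = C ` Q" using finite_subset_image[OF F] by metis
    then show ?thesis using local[OF Q(1)] by (auto simp: C_def)
  qed
  ultimately have "\<Inter>(range C) \<noteq> {}"
    using \<open>compact_space X\<close> unfolding compact_space_fip by (metis rangeE)
  then show ?thesis by (auto simp: C_def)
qed

section \<open>Decomposition of the covering of the plane\<close>

theorem corollary4:
  fixes T :: "(real^2) set" and I :: "'i set" and P :: "'i \<Rightarrow> (real^2) set"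
  assumes "open_triangle T"
    and "\<And>i. i \<in> I \<Longrightarrow> is_translate (P i) T"
    and "fold_covering 12 I P UNIV"
  shows "\<exists>I1 I2. I1 \<union> I2 = I \<and> I1 \<inter> I2 = {} \<and> covering I1 P UNIV \<and> covering I2 P UNIV"
proof -
  obtain v where v: "\<And>i. i \<in> I \<Longrightarrow> P i = (\<lambda>u. u + v i) ` T"
    using assms(2) unfolding is_translate_def by metis
  have T: "open T" "bounded T"
  proof -
    obtain a b c where abc: "T = interior (convex hull {a, b, c})"
      using assms(1) unfolding open_triangle_def by blast
    have "bounded (convex hull {a, b, c})" by (simp add: bounded_convex_hull finite_imp_bounded)
    then show "open T" "bounded T" unfolding abc by (simp_all add: bounded_interior)
  qed
  obtain d where "\<And>p q. p \<in> T \<Longrightarrow> q \<in> T \<Longrightarrow> dist p q \<le> d"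
    using T(2) unfolding bounded_two_points by blast
  then have diam: "dist p q \<le> d" if "i \<in> I" "p \<in> P i" "q \<in> P i" for i p q
    using that(2,3) unfolding v[OF that(1)] by auto
  have op: "open (P i)" if "i \<in> I" for i
    using open_translation[OF T(1), of "v i"] unfolding v[OF that] by (simp add: add.commute)
  obtain J where J: "J \<subseteq> I" "fold_covering 12 J P UNIV" and fin: "\<And>q. finite {i \<in> J. q \<in> P i}"
  proof (rule locally_finite_fold_subcovering[of I P d 12])
    show "fold_covering 12 I P UNIV" by (rule assms(3))
  qed (simp_all add: op diam)
  have twelve: "12 \<le> card {i \<in> J. q \<in> P i}" for q
    using J(2) fin unfolding fold_covering_iff_card by blast
  obtain X Y Z A B C :: "real^2 \<Rightarrow> real"
    where oct: "\<And>q w. q \<in> (\<lambda>u. u + w) ` T \<longleftrightarrow> X w < A q \<and> Y w < B q \<and> Z w < C q"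
    by (rule translates_as_octants[OF assms(1)]) blast
  have "\<exists>col. \<forall>q\<in>Q. (\<exists>i\<in>{i \<in> J. q \<in> P i}. col i) \<and> (\<exists>i\<in>{i \<in> J. q \<in> P i}. \<not> col i)"
    if Q: "finite Q" for Q
  proof -
    \<comment> \<open>All indices of \<open>J\<close> that cover some point of \<open>Q\<close>: for
      \<open>q\<close> in \<open>Q\<close> the octant of \<open>q\<close> then captures every index
      of \<open>J\<close> covering \<open>q\<close>, at least 12 of them.\<close>
    let ?A = "\<Union>q\<in>Q. {i \<in> J. q \<in> P i}"
    let ?O = "\<lambda>q. {i \<in> ?A. X (v i) < A q \<and> Y (v i) < B q \<and> Z (v i) < C q}"
    have "finite ?A" using Q fin by blast
    from octants_bichromatic[OF this, of "\<lambda>i. X (v i)" "\<lambda>i. Y (v i)" "\<lambda>i. Z (v i)"]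
    obtain col where col: "\<forall>a b c. 12 \<le> card {i \<in> ?A. X (v i) < a \<and> Y (v i) < b \<and> Z (v i) < c} \<longrightarrow>
        (\<exists>i\<in>?A. X (v i) < a \<and> Y (v i) < b \<and> Z (v i) < c \<and> col i) \<and>
        (\<exists>i\<in>?A. X (v i) < a \<and> Y (v i) < b \<and> Z (v i) < c \<and> \<not> col i)"
      by (rule exE)
    have "(\<exists>i\<in>{i \<in> J. q \<in> P i}. col i) \<and> (\<exists>i\<in>{i \<in> J. q \<in> P i}. \<not> col i)" if "q \<in> Q" for q
    proof -
      have "i \<in> I \<Longrightarrow> q \<in> P i \<longleftrightarrow> X (v i) < A q \<and> Y (v i) < B q \<and> Z (v i) < C q" for i
        using oct v by simp
      then have eq: "?O q = {i \<in> J. q \<in> P i}" using that J(1) by blast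
      then have "12 \<le> card (?O q)" using twelve by simp
      then have "(\<exists>i\<in>?O q. col i) \<and> (\<exists>i\<in>?O q. \<not> col i)"
        using col[rule_format, of "A q" "B q" "C q"] by blast
      then show ?thesis unfolding eq .
    qed
    then show ?thesis by blast
  qed
  then obtain col where
    col: "\<And>q. (\<exists>i\<in>{i \<in> J. q \<in> P i}. col i) \<and> (\<exists>i\<in>{i \<in> J. q \<in> P i}. \<not> col i)"
    using two_colouring_compactness[of "\<lambda>q. {i \<in> J. q \<in> P i}"] fin by blast
  \<comment> \<open>Both colours already cover the plane within \<open>J\<close>; the remaining
    indices of \<open>I\<close> may go to either class.\<close>
  have "covering {i \<in> I. col i} P UNIV" "covering {i \<in> I. \<not> col i} P UNIV"
    unfolding covering_iff using col J(1) by blast+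
  then show ?thesis
    by (intro exI[of _ "{i \<in> I. col i}"] exI[of _ "{i \<in> I. \<not> col i}"]) auto
qed

end
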